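(* For all positive integers $m$ and $n$, $$N(n,m;t)=t^{1-m}\sum_{T\in\mathcal{T}_{(n^m)}} t^{\operatorname{des}(T)}.$$
   Context: For positive integers $m,n$, a lattice word of weight $(m^n)$ is a word $\mathtt{w}=w_1w_2\cdots w_{nm}$ in the symbols $1,2,\ldots,m$ such that (a) each $i$ with $1\le i\le m$ occurs exactly $n$ times, and (b) for each $1\le r\le nm$ and each $1\le i\le m-1$, the number of $i$'s in $w_1\cdots w_r$ is at least the number of $(i+1)$'s in $w_1\cdots w_r$. Let $\mathcal{N}(n,m)$ be the set of such words. A descent of a word $\mathtt{w}=w_1\cdots w_p$ is an index $i$ with $w_i>w_{i+1}$, and $\operatorname{des}(\mathtt{w})$ is the number of descents; $N(n,m;t)=\sum_{\mathtt{w}\in\mathcal{N}(n,m)} t^{\operatorname{des}(\mathtt{w})}$. $(n^m)$ denotes the partition $(n,n,\ldots,n)$ with $m$ parts, i.e. the rectangular Young diagram with $m$ rows each of length $n$. $\mathcal{T}_{(n^m)}$ is the set of standard Young tableaux of this shape (fillings by $1,\ldots,nm$, each used once, increasing along rows and down columns). For a standard Young tableau $T$, $i$ is a descent of $T$ if $i+1$ appears in a strictly lower row of $T$ than $i$; $\operatorname{des}(T)$ is the number of descents of $T$. *)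

theory Defs
  imports
    "HOL-Library.FuncSet"
    "HOL-Computational_Algebra.Polynomial_FPS"
    "HOL-Computational_Algebra.Formal_Laurent_Series"
begin

text \<open>The letters are \<open>1, \<dots>, m\<close>; only the positions in the list are counted from 0.\<close>

definition lattice_words :: "nat \<Rightarrow> nat \<Rightarrow> nat list set" where
  "lattice_words n m = {w. length w = n * m \<and> set w \<subseteq> {1..m} \<and>
     (\<forall>i\<in>{1..m}. count_list w i = n) \<and>
     (\<forall>r\<in>{1..n * m}. \<forall>i\<in>{1..<m}. count_list (take r w) i \<ge> count_list (take r w) (Suc i))}"

definition word_des :: "nat list \<Rightarrow> nat" where
  "word_des w = card {i. Suc i < length w \<and> w ! i > w ! Suc i}"

definition lattice_word_poly :: "nat \<Rightarrow> nat \<Rightarrow> int poly" where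
  "lattice_word_poly n m = (\<Sum>w\<in>lattice_words n m. monom 1 (word_des w))"

text \<open>A partition is the list of its parts. Its diagram is drawn in English notation:
  cell \<open>(i, j)\<close> is in row \<open>i\<close> and column \<open>j\<close>, both counted from 0, and rows with a larger
  index are lower.\<close>

definition young_diagram :: "nat list \<Rightarrow> (nat \<times> nat) set" where
  "young_diagram p = {(i, j). i < length p \<and> j < p ! i}"

text \<open>The values outside the diagram are fixed by \<^const>\<open>extensional\<close>, so that distinct
  functions are distinct tableaux.\<close>

definition std_tableaux :: "nat list \<Rightarrow> (nat \<times> nat \<Rightarrow> nat) set" where
  "std_tableaux p = {T \<in> extensional (young_diagram p).
     bij_betw T (young_diagram p) {1..card (young_diagram p)} \<and>
     (\<forall>i j j'. (i, j) \<in> young_diagram p \<and> (i, j') \<in> young_diagram p \<and> j < j' \<longrightarrow>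
        T (i, j) < T (i, j')) \<and>
     (\<forall>i i' j. (i, j) \<in> young_diagram p \<and> (i', j) \<in> young_diagram p \<and> i < i' \<longrightarrow>
        T (i, j) < T (i', j))}"

definition tableau_des :: "nat list \<Rightarrow> (nat \<times> nat \<Rightarrow> nat) \<Rightarrow> nat" where
  "tableau_des p T = card {k. \<exists>i j i' j'. (i, j) \<in> young_diagram p \<and> (i', j') \<in> young_diagram p \<and>
     T (i, j) = k \<and> T (i', j') = Suc k \<and> i < i'}"

lemma finite_lattice_words: "finite (lattice_words n m)"
  by (rule finite_subset[OF _ finite_lists_length_eq[of "{1..m}" "n * m"]])
    (auto simp: lattice_words_def)

lemma finite_young_diagram: "finite (young_diagram p)"
proof -
  have "young_diagram p = (SIGMA i:{..<length p}. {..<p ! i})"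
    by (auto simp: young_diagram_def)
  then show ?thesis by simp
qed

lemma finite_std_tableaux: "finite (std_tableaux p)"
  by (rule finite_subset[OF _ finite_PiE[OF finite_young_diagram[of p],
        of "\<lambda>_. {1..card (young_diagram p)}"]])
    (auto simp: std_tableaux_def PiE_def bij_betw_def)

end

theory Submission
  imports Defs "HOL-Library.Multiset"
begin

text \<open>
Replacing each entry of a tableau by the number of its row turns the claim into: over lattice
words, the number of ascents is distributed as \<open>m - 1\<close> plus the number of descents. Cut a word
of length \<open>p\<close> into \<open>r + 1\<close> weakly increasing (possibly empty) blocks. A cut is forced at each
descent and the others are free, so the cuttings have generating function
\<open>X ^ des / (1 - X) ^ (p + 1)\<close> in \<open>r\<close>; with weakly decreasing blocks, ascents take the place of
descents. A list of monotone blocks is determined by the number \<open>a i x\<close> of letters \<open>i\<close> in block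
\<open>x\<close>, and the lattice condition becomes
\<open>(\<Sum>y<x. a (i + 1) y) \<le> (\<Sum>y<x. a i y)\<close> in the increasing case and
\<open>(\<Sum>y\<le>x. a (i + 1) y) \<le> (\<Sum>y<x. a i y)\<close> in the decreasing one. Shifting row \<open>i\<close> by \<open>i - 1\<close>
is a bijection between the two kinds of matrices and increases \<open>r\<close> by \<open>m - 1\<close>. (These matrices
encode the weak and the column-strict plane partitions in Stanley's theory of
\<open>(P, \<omega>)\<close>-partitions.)
\<close>

subsection \<open>Cutting a word into monotone blocks\<close>

text \<open>The relation is a parameter so that one argument serves both statistics:
  \<open>(\<le>)\<close> gives the descents, \<open>(\<ge>)\<close> the strict ascents.\<close>

definition breaks :: "('a \<Rightarrow> 'a \<Rightarrow> bool) \<Rightarrow> 'a list \<Rightarrow> nat" where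
  "breaks R w = card {i. Suc i < length w \<and> \<not> R (w ! i) (w ! Suc i)}"

lemma breaks_Nil [simp]: "breaks R [] = 0"
  and breaks_single [simp]: "breaks R [a] = 0"
  by (simp_all add: breaks_def)

lemma breaks_Cons_Cons:
  "breaks R (a # b # w) = of_bool (\<not> R a b) + breaks R (b # w)"
proof -
  let ?D = "\<lambda>w. {i. Suc i < length w \<and> \<not> R (w ! i) (w ! Suc i)}"
  have "?D (a # b # w) = (if R a b then {} else {0}) \<union> Suc ` ?D (b # w)"
    by (auto simp: image_iff less_Suc_eq_0_disj split: if_splits)
  moreover have "finite (?D (b # w))"
    by (rule finite_subset[of _ "{..<length (b # w)}"]) auto
  ultimately show ?thesis
    unfolding breaks_def by (auto simp: card_image card_insert_if)
qed

text \<open>\<open>r\<close> counts cuts, not blocks. Since blocks may be empty, several cuts can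
  share a place, also before the first or after the last letter.\<close>

definition splits :: "('a \<Rightarrow> 'a \<Rightarrow> bool) \<Rightarrow> nat \<Rightarrow> 'a list \<Rightarrow> 'a list list set" where
  "splits R r w = {bs. length bs = Suc r \<and> concat bs = w \<and> (\<forall>b\<in>set bs. successively R b)}"

lemma splits_Nil: "splits R r [] = {replicate (Suc r) []}"
  by (auto simp: splits_def simp del: replicate_Suc intro!: replicate_eqI)

lemma splits_hd_Nil_0: "w \<noteq> [] \<Longrightarrow> {bs \<in> splits R 0 w. hd bs = []} = {}"
  by (auto simp: splits_def length_Suc_conv)

lemma splits_hd_Nil_Suc: "{bs \<in> splits R (Suc r) w. hd bs = []} = Cons [] ` splits R r w"
  by (auto simp: splits_def length_Suc_conv image_iff)

text \<open>Deleting \<open>a\<close> from the first block, which may become empty, leaves a cutting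
  of \<open>w\<close>. Putting \<open>a\<close> back is allowed unless it would stand before a
  letter of the same block that is not \<open>R\<close>-related to it.\<close>

lemma splits_hd_Cons:
  "{bs \<in> splits R r (a # w). hd bs \<noteq> []} =
     (\<lambda>bs. (a # hd bs) # tl bs) ` {bs \<in> splits R r w. hd bs = [] \<or> R a (hd (hd bs))}"
  (is "?A = ?f ` ?B")
proof
  show "?A \<subseteq> ?f ` ?B"
  proof
    fix bs assume "bs \<in> ?A"
    then obtain b cs where bs: "bs = (a # b) # cs" and "bs \<in> splits R r (a # w)"
      by (cases bs; cases "hd bs") (auto simp: splits_def)
    then have "b # cs \<in> ?B"
      by (auto simp: splits_def successively_Cons)
    then show "bs \<in> ?f ` ?B"
      by (rule rev_image_eqI) (simp add: bs)
  qed
  show "?f ` ?B \<subseteq> ?A"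
    by (auto simp: splits_def length_Suc_conv successively_Cons)
qed

lemma inj_on_Cons_hd: "inj_on (\<lambda>bs. (a # hd bs) # tl bs) {bs \<in> splits R r w. P bs}"
proof (rule inj_onI)
  fix bs cs
  assume "bs \<in> {bs \<in> splits R r w. P bs}" and "cs \<in> {bs \<in> splits R r w. P bs}"
    and eq: "(a # hd bs) # tl bs = (a # hd cs) # tl cs"
  then have "bs \<noteq> []" and "cs \<noteq> []"
    by (auto simp: splits_def)
  with eq show "bs = cs"
    by (simp add: list.expand)
qed

text \<open>The nested induction follows the two ways to shrink a cutting: dropping an empty first
  block lowers \<open>r\<close>, dropping the first letter shortens the word.\<close>

lemma finite_splits: "finite (splits R r w)"
proof (induction w arbitrary: r)
  case Nil
  show ?case by (simp add: splits_Nil)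
next
  case (Cons a w)
  note w = Cons
  show ?case
  proof (induction r)
    case 0
    have "splits R 0 (a # w) = {bs \<in> splits R 0 (a # w). hd bs \<noteq> []}"
      using splits_hd_Nil_0[of "a # w" R] by auto
    then show ?case using w by (simp add: splits_hd_Cons)
  next
    case (Suc r)
    have "splits R (Suc r) (a # w) = {bs \<in> splits R (Suc r) (a # w). hd bs = []} \<union>
        {bs \<in> splits R (Suc r) (a # w). hd bs \<noteq> []}" by auto
    then show ?case using w Suc by (simp add: splits_hd_Cons splits_hd_Nil_Suc)
  qed
qed

section \<open>Generating functions of cuttings\<close>

definition splits_fps :: "('a \<Rightarrow> 'a \<Rightarrow> bool) \<Rightarrow> 'a list \<Rightarrow> int fps" where
  "splits_fps R w = Abs_fps (\<lambda>r. int (card (splits R r w)))"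

text \<open>Dropping the empty first block uses up one cut, hence the factor \<open>fps_X\<close>.
  With no cut, the only block is the nonempty word itself, so the constant coefficient is 0.\<close>

lemma splits_fps_hd_Nil:
  assumes "w \<noteq> []"
  shows "Abs_fps (\<lambda>r. int (card {bs \<in> splits R r w. hd bs = []})) = fps_X * splits_fps R w"
proof (rule fps_ext)
  fix r
  show "Abs_fps (\<lambda>r. int (card {bs \<in> splits R r w. hd bs = []})) $ r = (fps_X * splits_fps R w) $ r"
    using assms
    by (cases r) (simp_all only: splits_fps_def fps_X_mult_nth splits_hd_Nil_0[OF assms]
        splits_hd_Nil_Suc card_image[OF inj_on_Cons1] fps_nth_Abs_fps, simp_all)
qed

text \<open>Cuttings with an empty first block contribute \<open>fps_X\<close> times the whole
  series; moving this term to the left gives the factor \<open>1 - fps_X\<close>. The other cuttings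
  are those of \<open>splits_hd_Cons\<close>.\<close>

lemma splits_fps_Cons:
  "(1 - fps_X) * splits_fps R (a # w) =
     Abs_fps (\<lambda>r. int (card {bs \<in> splits R r w. hd bs = [] \<or> R a (hd (hd bs))}))"
proof -
  have "card (splits R r (a # w)) = card {bs \<in> splits R r (a # w). hd bs = []} +
      card {bs \<in> splits R r w. hd bs = [] \<or> R a (hd (hd bs))}" for r
  proof -
    have "splits R r (a # w) = {bs \<in> splits R r (a # w). hd bs = []} \<union>
        {bs \<in> splits R r (a # w). hd bs \<noteq> []}" by auto
    also have "card \<dots> = card {bs \<in> splits R r (a # w). hd bs = []} +
        card {bs \<in> splits R r (a # w). hd bs \<noteq> []}"
      using finite_splits[of R r "a # w"] by (intro card_Un_disjoint) auto
    finally show ?thesis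
      by (simp add: splits_hd_Cons card_image[OF inj_on_Cons_hd])
  qed
  then have "splits_fps R (a # w) = Abs_fps (\<lambda>r. int (card {bs \<in> splits R r (a # w). hd bs = []})) +
      Abs_fps (\<lambda>r. int (card {bs \<in> splits R r w. hd bs = [] \<or> R a (hd (hd bs))}))"
    by (intro fps_ext) (simp add: splits_fps_def)
  then show ?thesis
    by (simp add: splits_fps_hd_Nil algebra_simps)
qed

lemma splits_fps_Nil: "(1 - fps_X) * splits_fps R [] = 1"
  by (intro fps_ext) (simp add: splits_fps_def splits_Nil left_diff_distrib)

lemma splits_fps_eq: "(1 - fps_X) ^ Suc (length w) * splits_fps R w = fps_X ^ breaks R w"
proof (induction w)
  case Nil
  then show ?case by (simp add: splits_fps_Nil)
next
  case (Cons a w)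
  \<comment> \<open>The exponent below is a truncated difference; this makes it a genuine
    one.\<close>
  have le: "breaks R w \<le> breaks R (a # w)"
    by (cases w) (simp_all add: breaks_Cons_Cons)
  \<comment> \<open>A new cut is forced exactly when \<open>w\<close> starts with some
    \<open>b\<close> such that \<open>R a b\<close> fails. Then the first block of the cutting of
    \<open>w\<close> must be empty, which costs one factor \<open>fps_X\<close>.\<close>
  have *: "Abs_fps (\<lambda>r. int (card {bs \<in> splits R r w. hd bs = [] \<or> R a (hd (hd bs))})) =
      fps_X ^ (breaks R (a # w) - breaks R w) * splits_fps R w"
  proof (cases w)
    case Nil
    then have "{bs \<in> splits R r w. hd bs = [] \<or> R a (hd (hd bs))} = splits R r w" for r
      by (auto simp: splits_def length_Suc_conv)
    then show ?thesis by (simp add: splits_fps_def Nil)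
  next
    case (Cons b v)
    have hd: "hd (hd bs) = b" if "bs \<in> splits R r w" "hd bs \<noteq> []" for bs r
      using that by (auto simp: splits_def Cons length_Suc_conv neq_Nil_conv)
    show ?thesis
    proof (cases "R a b")
      case True
      then have "{bs \<in> splits R r w. hd bs = [] \<or> R a (hd (hd bs))} = splits R r w" for r
        using hd by auto
      with True show ?thesis by (simp add: splits_fps_def Cons breaks_Cons_Cons)
    next
      case False
      then have "{bs \<in> splits R r w. hd bs = [] \<or> R a (hd (hd bs))} =
          {bs \<in> splits R r w. hd bs = []}" for r
        using hd by auto
      with False show ?thesis
        using splits_fps_hd_Nil[of w R] by (simp add: Cons breaks_Cons_Cons)
    qed
  qed
  have "(1 - fps_X) ^ Suc (length (a # w)) * splits_fps R (a # w) =
      (1 - fps_X) ^ Suc (length w) * ((1 - fps_X) * splits_fps R (a # w))"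
    by (simp only: length_Cons power_Suc[of _ "Suc (length w)"] mult.assoc mult.left_commute)
  also have "\<dots> = fps_X ^ (breaks R (a # w) - breaks R w) *
      ((1 - fps_X) ^ Suc (length w) * splits_fps R w)"
    unfolding splits_fps_Cons * by (rule mult.left_commute)
  also have "\<dots> = fps_X ^ breaks R (a # w)"
    unfolding Cons.IH using le by (simp flip: power_add)
  finally show ?case .
qed

definition blocks :: "('a \<Rightarrow> 'a \<Rightarrow> bool) \<Rightarrow> 'a list set \<Rightarrow> nat \<Rightarrow> 'a list list set" where
  "blocks R L r = {bs. length bs = Suc r \<and> (\<forall>b\<in>set bs. successively R b) \<and> concat bs \<in> L}"

text \<open>A list of blocks determines its concatenation, so \<open>blocks R L r\<close> is the
  disjoint union of the sets \<open>splits R r w\<close>. As all words have length \<open>p\<close>,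
  the power of \<open>1 - fps_X\<close> is common to all summands.\<close>

lemma sum_power_breaks:
  assumes "finite L" and "\<And>w. w \<in> L \<Longrightarrow> length w = p"
  shows "(\<Sum>w\<in>L. fps_X ^ breaks R w) =
    (1 - fps_X) ^ Suc p * Abs_fps (\<lambda>r. int (card (blocks R L r)))"
proof -
  have "blocks R L r = (\<Union>w\<in>L. splits R r w)" for r
    by (auto simp: blocks_def splits_def)
  then have "card (blocks R L r) = (\<Sum>w\<in>L. card (splits R r w))" for r
    by (simp, subst card_UN_disjoint) (auto simp: assms(1) finite_splits, auto simp: splits_def)
  then have "Abs_fps (\<lambda>r. int (card (blocks R L r))) = (\<Sum>w\<in>L. splits_fps R w)"
    by (intro fps_ext) (simp add: splits_fps_def fps_sum_nth)
  then show ?thesis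
    by (simp add: sum_distrib_left assms(2) flip: splits_fps_eq del: power_Suc)
qed

subsection \<open>Weak and strict matrices\<close>

text \<open>Rows are letters and columns are block numbers. Vanishing outside this range makes each
  matrix a single function; for \<open>x\<close> beyond \<open>r\<close> both partial sums are
  \<open>n\<close>.\<close>

definition weak_matrices :: "nat \<Rightarrow> nat \<Rightarrow> nat \<Rightarrow> (nat \<Rightarrow> nat \<Rightarrow> nat) set" where
  "weak_matrices n m r = {a. (\<forall>i x. a i x \<noteq> 0 \<longrightarrow> i \<in> {1..m} \<and> x \<le> r) \<and>
     (\<forall>i\<in>{1..m}. (\<Sum>x<Suc r. a i x) = n) \<and>
     (\<forall>i\<in>{1..<m}. \<forall>x. (\<Sum>y<x. a (Suc i) y) \<le> (\<Sum>y<x. a i y))}"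

definition strict_matrices :: "nat \<Rightarrow> nat \<Rightarrow> nat \<Rightarrow> (nat \<Rightarrow> nat \<Rightarrow> nat) set" where
  "strict_matrices n m r = {a. (\<forall>i x. a i x \<noteq> 0 \<longrightarrow> i \<in> {1..m} \<and> x \<le> r) \<and>
     (\<forall>i\<in>{1..m}. (\<Sum>x<Suc r. a i x) = n) \<and>
     (\<forall>i\<in>{1..<m}. \<forall>x. (\<Sum>y<Suc x. a (Suc i) y) \<le> (\<Sum>y<x. a i y))}"

lemma weak_matricesD:
  assumes "a \<in> weak_matrices n m r"
  shows "a i x \<noteq> 0 \<Longrightarrow> 1 \<le> i \<and> i \<le> m \<and> x \<le> r"
    and "1 \<le> i \<Longrightarrow> i \<le> m \<Longrightarrow> (\<Sum>x<Suc r. a i x) = n"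
    and "1 \<le> i \<Longrightarrow> i < m \<Longrightarrow> (\<Sum>y<x. a (Suc i) y) \<le> (\<Sum>y<x. a i y)"
  using assms unfolding weak_matrices_def by (simp_all del: sum.lessThan_Suc)

lemma strict_matricesD:
  assumes "a \<in> strict_matrices n m r"
  shows "a i x \<noteq> 0 \<Longrightarrow> 1 \<le> i \<and> i \<le> m \<and> x \<le> r"
    and "1 \<le> i \<Longrightarrow> i \<le> m \<Longrightarrow> (\<Sum>x<Suc r. a i x) = n"
    and "1 \<le> i \<Longrightarrow> i < m \<Longrightarrow> (\<Sum>y<Suc x. a (Suc i) y) \<le> (\<Sum>y<x. a i y)"
  using assms unfolding strict_matrices_def by (simp_all del: sum.lessThan_Suc)

text \<open>Row \<open>i\<close> moves \<open>i - 1\<close> columns to the right. The guard fills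
  the vacated columns with 0, where truncated subtraction would repeat \<open>a i 0\<close>.\<close>

definition shift_rows :: "(nat \<Rightarrow> nat \<Rightarrow> nat) \<Rightarrow> nat \<Rightarrow> nat \<Rightarrow> nat" where
  "shift_rows a i x = (if i \<le> Suc x then a i (Suc x - i) else 0)"

lemma sum_shift_rows:
  assumes "i \<ge> 1"
  shows "(\<Sum>y<x. shift_rows a i y) = (\<Sum>y<Suc x - i. a i y)"
proof (induction x)
  case 0
  then show ?case using assms by simp
next
  case (Suc x)
  then show ?case by (simp add: shift_rows_def Suc_diff_le)
qed

lemma sum_lessThan_bounded_support:
  fixes f :: "nat \<Rightarrow> nat"
  assumes "\<And>x. f x \<noteq> 0 \<Longrightarrow> x < k" and "k \<le> l"
  shows "(\<Sum>x<l. f x) = (\<Sum>x<k. f x)"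
  by (rule sum.mono_neutral_right) (use assms in force)+

text \<open>Each row can start only one column after the previous one, so row \<open>Suc i\<close>
  is empty in its first \<open>i\<close> columns.\<close>

lemma strict_matrices_low:
  assumes "b \<in> strict_matrices n m r" and "Suc i \<le> m"
  shows "(\<Sum>y<i. b (Suc i) y) = 0"
  using assms(2)
proof (induction i)
  case (Suc i)
  then have "(\<Sum>y<Suc i. b (Suc (Suc i)) y) \<le> (\<Sum>y<i. b (Suc i) y)"
    by (intro strict_matricesD(3)[OF assms(1)]) auto
  with Suc show ?case by simp
qed simp

text \<open>Downward induction from row \<open>m\<close>, which has all \<open>r + m\<close> columns
  available: each row must be complete one column before the next one is.\<close>

lemma strict_matrices_high:
  assumes "b \<in> strict_matrices n m (r + m - 1)" and "1 \<le> i" and "i \<le> m"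
  shows "(\<Sum>y<r + i. b i y) = n"
  using assms(3,2)
proof (induction i rule: inc_induct)
  case base
  have "Suc (r + m - 1) = r + m" using base by simp
  then show ?case using strict_matricesD(2)[OF assms(1), of m] base by simp
next
  case (step i)
  have "n = (\<Sum>y<Suc (r + i). b (Suc i) y)"
    using step by simp
  also have "\<dots> \<le> (\<Sum>y<r + i. b i y)"
    using step by (intro strict_matricesD(3)[OF assms(1)]) auto
  finally have "n \<le> (\<Sum>y<r + i. b i y)" .
  moreover have "(\<Sum>y<r + i. b i y) \<le> (\<Sum>y<Suc (r + m - 1). b i y)"
    using step by (intro sum_mono2) auto
  moreover have "\<dots> = n"
    using step by (intro strict_matricesD(2)[OF assms(1)]) auto
  ultimately show ?case by simp
qed

text \<open>Row \<open>i\<close> occupies only the \<open>r + 1\<close> columns from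
  \<open>i - 1\<close> to \<open>r + i - 1\<close>, so it can be shifted back without losing
  entries.\<close>

lemma strict_matrices_support:
  assumes b: "b \<in> strict_matrices n m (r + m - 1)" and nz: "b i x \<noteq> 0"
  shows "1 \<le> i" "i \<le> m" "i \<le> Suc x" "x < r + i"
proof -
  have x: "x \<le> r + m - 1" and i: "1 \<le> i" "i \<le> m"
    using strict_matricesD(1)[OF assms] by blast+
  then show "1 \<le> i" "i \<le> m" by blast+
  show "i \<le> Suc x"
  proof (rule ccontr)
    assume "\<not> i \<le> Suc x"
    then have "x < i - 1" by simp
    moreover have "(\<Sum>y<i - 1. b i y) = 0"
      using strict_matrices_low[OF b, of "i - 1"] i by simp
    ultimately show False using nz by simp
  qed
  show "x < r + i"
  proof (rule ccontr)
    assume x': "\<not> x < r + i"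
    \<comment> \<open>The first \<open>r + i\<close> columns already sum to \<open>n\<close>, so a
      further nonzero entry would exceed the row sum.\<close>
    have "(\<Sum>y\<in>insert x {..<r + i}. b i y) \<le> (\<Sum>y<Suc (r + m - 1). b i y)"
      using i x by (intro sum_mono2) auto
    also have "\<dots> = n"
      using i by (intro strict_matricesD(2)[OF b]) auto
    also have "\<dots> = (\<Sum>y<r + i. b i y)"
      using strict_matrices_high[OF b i] by simp
    finally show False using x' nz by simp
  qed
qed

text \<open>Row \<open>m\<close> cannot start before column \<open>m - 1\<close>, which lies beyond
  \<open>r\<close>, yet its sum is positive.\<close>

lemma strict_matrices_empty:
  assumes "n \<ge> 1" and "r < m - 1"
  shows "strict_matrices n m r = {}"
proof (rule ccontr)
  assume "strict_matrices n m r \<noteq> {}"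
  then obtain b where b: "b \<in> strict_matrices n m r" by blast
  have "(\<Sum>y<m - 1. b m y) = 0"
    using strict_matrices_low[OF b, of "m - 1"] assms by simp
  moreover have "(\<Sum>y<Suc r. b m y) \<le> (\<Sum>y<m - 1. b m y)"
    using assms by (intro sum_mono2) auto
  moreover have "(\<Sum>y<Suc r. b m y) = n"
    using assms by (intro strict_matricesD(2)[OF b]) auto
  ultimately show False using assms by simp
qed

lemma shift_rows_strict:
  assumes a: "a \<in> weak_matrices n m r"
  shows "shift_rows a \<in> strict_matrices n m (r + m - 1)"
  unfolding strict_matrices_def
proof (intro CollectI conjI allI ballI impI)
  have supp: "a i x \<noteq> 0 \<Longrightarrow> 1 \<le> i \<and> i \<le> m \<and> x \<le> r" for i x
    using weak_matricesD(1)[OF a] .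
  show "i \<in> {1..m}" "x \<le> r + m - 1" if "shift_rows a i x \<noteq> 0" for i x
    using supp[of i "Suc x - i"] that unfolding shift_rows_def by (auto split: if_splits)
  show "(\<Sum>x<Suc (r + m - 1). shift_rows a i x) = n" if i: "i \<in> {1..m}" for i
  proof -
    have "(\<Sum>x<Suc (r + m - 1). shift_rows a i x) = (\<Sum>y<Suc (Suc (r + m - 1)) - i. a i y)"
      using i by (intro sum_shift_rows) simp
    also have "\<dots> = (\<Sum>y<Suc r. a i y)"
      using i supp by (intro sum_lessThan_bounded_support) (fastforce simp: less_Suc_eq_le)+
    also have "\<dots> = n" using weak_matricesD(2)[OF a] i by simp
    finally show ?thesis .
  qed
  show "(\<Sum>y<Suc x. shift_rows a (Suc i) y) \<le> (\<Sum>y<x. shift_rows a i y)"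
    if i: "i \<in> {1..<m}" for i x
  proof -
    \<comment> \<open>Both sides of the strict condition pull back to the same number
      \<open>Suc x - i\<close> of columns, because row \<open>Suc i\<close> is shifted one column
      further than row \<open>i\<close>.\<close>
    have "(\<Sum>y<Suc x - i. a (Suc i) y) \<le> (\<Sum>y<Suc x - i. a i y)"
      using weak_matricesD(3)[OF a] i by simp
    then show ?thesis
      using i sum_shift_rows[of "Suc i" a "Suc x"] sum_shift_rows[of i a x] by simp
  qed
qed

lemma inj_on_shift_rows: "inj_on shift_rows (weak_matrices n m r)"
proof (intro inj_onI ext)
  fix a b i x
  assume a: "a \<in> weak_matrices n m r" and b: "b \<in> weak_matrices n m r"
    and eq: "shift_rows a = shift_rows b"
  show "a i x = b i x"
  proof (cases i)
    \<comment> \<open>The shift drops the entry \<open>a 0 0\<close>, so row 0 is compared through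
      the support condition instead.\<close>
    case 0
    then show ?thesis using weak_matricesD(1)[OF a, of i x] weak_matricesD(1)[OF b, of i x]
      by (cases "a i x = 0"; cases "b i x = 0") auto
  next
    case (Suc j)
    then show ?thesis using fun_cong[OF fun_cong[OF eq, of i], of "x + j"]
      by (simp add: shift_rows_def)
  qed
qed

lemma shift_rows_image:
  "shift_rows ` weak_matrices n m r = strict_matrices n m (r + m - 1)"
proof (intro equalityI subsetI)
  fix b assume b: "b \<in> strict_matrices n m (r + m - 1)"
  note supp = strict_matrices_support[OF b]
  \<comment> \<open>The inverse shift; by the support bounds no nonzero entry falls off on the
    left.\<close>
  define a where "a i x = (if i = 0 then 0 else b i (x + i - 1))" for i x
  have sh: "shift_rows a = b"
  proof (intro ext)
    fix i x
    show "shift_rows a i x = b i x"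
      using supp(1,3)[of i x] by (cases "b i x = 0") (auto simp: shift_rows_def a_def)
  qed
  have "a \<in> weak_matrices n m r"
    unfolding weak_matrices_def
  proof (intro CollectI conjI allI ballI impI)
    have asupp: "i \<in> {1..m} \<and> x \<le> r" if "a i x \<noteq> 0" for i x
      using supp[of i "x + i - 1"] that by (auto simp: a_def split: if_splits)
    then show "i \<in> {1..m}" "x \<le> r" if "a i x \<noteq> 0" for i x
      using that by blast+
    show "(\<Sum>x<Suc r. a i x) = n" if i: "i \<in> {1..m}" for i
    proof -
      have "(\<Sum>x<Suc r. a i x) = (\<Sum>y<r + i. shift_rows a i y)"
        using i sum_shift_rows[of i a "r + i"] by simp
      then show ?thesis
        using strict_matrices_high[OF b, of i] i by (simp add: sh)
    qed
    show "(\<Sum>y<x. a (Suc i) y) \<le> (\<Sum>y<x. a i y)" if i: "i \<in> {1..<m}" for i x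
    proof (cases x)
      case (Suc z)
      \<comment> \<open>At column \<open>z + i\<close> the strict condition pulls back to the first
        \<open>Suc z\<close> columns of both rows.\<close>
      have "(\<Sum>y<Suc (z + i). shift_rows a (Suc i) y) \<le> (\<Sum>y<z + i. shift_rows a i y)"
        using strict_matricesD(3)[OF b, of i "z + i"] i unfolding sh by simp
      then show ?thesis
        using i sum_shift_rows[of "Suc i" a "Suc (z + i)"] sum_shift_rows[of i a "z + i"]
        by (simp add: Suc del: sum.lessThan_Suc)
    qed simp
  qed
  with sh show "b \<in> shift_rows ` weak_matrices n m r" by blast
qed (use shift_rows_strict in blast)

lemma card_strict_matrices:
  assumes "m \<ge> 1" "n \<ge> 1"
  shows "card (strict_matrices n m r) =
    (if r < m - 1 then 0 else card (weak_matrices n m (r - (m - 1))))"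
proof (cases "r < m - 1")
  case False
  then have "r = (r - (m - 1)) + m - 1" using assms by simp
  then show ?thesis
    using False shift_rows_image[of n m "r - (m - 1)"] card_image[OF inj_on_shift_rows]
    by (metis (no_types))
qed (use strict_matrices_empty[OF assms(2)] in auto)

subsection \<open>Blocks of lattice words as matrices\<close>

text \<open>Prefixes become left factors, which suits concatenations of blocks; the length follows
  from the letter counts.\<close>

lemma lattice_words_iff:
  "w \<in> lattice_words n m \<longleftrightarrow> set w \<subseteq> {1..m} \<and> (\<forall>i\<in>{1..m}. count_list w i = n) \<and>
     (\<forall>u v. w = u @ v \<longrightarrow> (\<forall>i\<in>{1..<m}. count_list u (Suc i) \<le> count_list u i))"
  (is "_ \<longleftrightarrow> ?S \<and> ?C \<and> ?P")
proof
  assume w: "w \<in> lattice_words n m"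
  have "count_list u (Suc i) \<le> count_list u i" if "w = u @ v" "i \<in> {1..<m}" for u v i
  proof (cases "u = []")
    case False
    with that w have "length u \<in> {1..n * m}"
      by (cases u) (auto simp: lattice_words_def)
    then have "count_list (take (length u) w) (Suc i) \<le> count_list (take (length u) w) i"
      using w that(2) unfolding lattice_words_def by blast
    with that show ?thesis by simp
  qed simp
  with w show "?S \<and> ?C \<and> ?P" by (auto simp: lattice_words_def)
next
  assume *: "?S \<and> ?C \<and> ?P"
  then have "length w = sum (count_list w) {1..m}"
    by (intro sum_count_set[symmetric]) auto
  also have "\<dots> = (\<Sum>i\<in>{1..m}. n)" using * by (intro sum.cong) auto
  also have "\<dots> = n * m" by simp
  finally have "length w = n * m" .
  moreover have "count_list (take r w) (Suc i) \<le> count_list (take r w) i" if "i \<in> {1..<m}" for r i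
    using * that append_take_drop_id[of r w, symmetric] by blast
  ultimately show "w \<in> lattice_words n m"
    using * by (simp add: lattice_words_def)
qed

definition block_counts :: "'a list list \<Rightarrow> 'a \<Rightarrow> nat \<Rightarrow> nat" where
  "block_counts bs i x = (if x < length bs then count_list (bs ! x) i else 0)"

lemma sum_block_counts: "(\<Sum>y<x. block_counts bs i y) = count_list (concat (take x bs)) i"
proof (induction x)
  case (Suc x)
  then show ?case
    by (cases "x < length bs") (simp_all add: block_counts_def take_Suc_conv_app_nth)
qed simp

lemma block_counts_nonzero:
  assumes "set (concat bs) \<subseteq> A" and "block_counts bs i x \<noteq> 0"
  shows "i \<in> A \<and> x < length bs"
proof -
  have "x < length bs" and "i \<in> set (bs ! x)"
    using assms(2) by (auto simp: block_counts_def count_list_0_iff split: if_splits simp del: neq0_conv)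
  moreover from this have "i \<in> set (concat bs)"
    by (auto intro: nth_mem)
  ultimately show ?thesis using assms(1) by blast
qed

lemma set_concat_subset_block_counts:
  assumes "\<And>i x. block_counts bs i x \<noteq> 0 \<Longrightarrow> i \<in> A"
  shows "set (concat bs) \<subseteq> A"
proof
  fix i assume "i \<in> set (concat bs)"
  then obtain b where "b \<in> set bs" "i \<in> set b" by auto
  then obtain x where "x < length bs" "i \<in> set (bs ! x)"
    by (metis in_set_conv_nth)
  then have "block_counts bs i x \<noteq> 0" by (simp add: block_counts_def count_list_0_iff)
  then show "i \<in> A" by (rule assms)
qed

lemma count_list_concat_block_counts:
  "length bs = k \<Longrightarrow> count_list (concat bs) i = (\<Sum>x<k. block_counts bs i x)"
  by (simp add: sum_block_counts)

section \<open>Monotone blocks and their letter counts\<close>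

lemma sorted_count_list_unique:
  fixes b c :: "'a :: linorder list"
  assumes "sorted b" "sorted c" "\<And>i. count_list b i = count_list c i"
  shows "b = c"
proof -
  have "mset b = mset c" using assms(3) by (intro multiset_eqI) (simp add: count_mset)
  then show ?thesis using assms(1,2) by (metis sorted_list_of_multiset_mset sorted_sort_id)
qed

lemma inj_on_block_counts:
  assumes "\<And>b c. b \<in> S \<Longrightarrow> c \<in> S \<Longrightarrow> (\<And>i. count_list b i = count_list c i) \<Longrightarrow> b = c"
  shows "inj_on block_counts {bs. length bs = k \<and> set bs \<subseteq> S}"
proof (rule inj_onI)
  fix bs cs
  assume bs: "bs \<in> {bs. length bs = k \<and> set bs \<subseteq> S}" and cs: "cs \<in> {bs. length bs = k \<and> set bs \<subseteq> S}"
    and eq: "block_counts bs = block_counts cs"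
  show "bs = cs"
  proof (rule nth_equalityI)
    fix x assume x: "x < length bs"
    have "count_list (bs ! x) i = count_list (cs ! x) i" for i
      using fun_cong[OF fun_cong[OF eq, of i], of x] x bs cs by (simp add: block_counts_def)
    then show "bs ! x = cs ! x"
      using x bs cs by (intro assms) (auto simp: subset_iff)
  qed (use bs cs in simp)
qed

lemma ex_sorted_count_list:
  fixes f :: "nat \<Rightarrow> nat"
  assumes "\<And>i. f i \<noteq> 0 \<Longrightarrow> i \<le> m"
  shows "\<exists>b. sorted b \<and> (\<forall>i. count_list b i = f i)"
proof -
  have "finite {i. f i > 0}"
    by (rule finite_subset[of _ "{..m}"]) (use assms in auto)
  then have "count (Abs_multiset f) = f" by (simp add: Abs_multiset_inverse)
  then have "count_list (sorted_list_of_multiset (Abs_multiset f)) i = f i" for i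
    by (metis count_mset mset_sorted_list_of_multiset)
  then show ?thesis
    using sorted_sorted_list_of_multiset by blast
qed

lemma ex_blocks_with_counts:
  assumes "\<And>f. (\<And>i. f i \<noteq> 0 \<Longrightarrow> i \<le> m) \<Longrightarrow> \<exists>b. P b \<and> (\<forall>i. count_list b i = f i)"
    and "\<And>i x. a i x \<noteq> 0 \<Longrightarrow> i \<le> m \<and> x < k"
  shows "\<exists>bs. length bs = k \<and> (\<forall>b\<in>set bs. P b) \<and> block_counts bs = a"
proof -
  have "\<exists>b. P b \<and> (\<forall>i. count_list b i = a i x)" for x
    using assms(2) by (intro assms(1)) blast
  then obtain g where g: "\<And>x. P (g x)" "\<And>x i. count_list (g x) i = a i x" by metis
  have "block_counts (map g [0..<k]) = a"
    using g(2) assms(2) by (auto simp: block_counts_def fun_eq_iff)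
  then show ?thesis using g(1) by (intro exI[of _ "map g [0..<k]"]) auto
qed

text \<open>With weakly increasing blocks the lattice condition need only be tested at block
  boundaries, and there it is the weak condition.\<close>

lemma concat_le_blocks_lattice_iff:
  assumes "length bs = Suc r" and sorted: "\<And>b. b \<in> set bs \<Longrightarrow> sorted b"
  shows "concat bs \<in> lattice_words n m \<longleftrightarrow> block_counts bs \<in> weak_matrices n m r"
proof
  assume L: "concat bs \<in> lattice_words n m"
  have split: "concat bs = concat (take x bs) @ concat (drop x bs)" for x
    by (metis append_take_drop_id concat_append)
  show "block_counts bs \<in> weak_matrices n m r"
    unfolding weak_matrices_def mem_Collect_eq
  proof (intro conjI allI ballI impI)
    show "i \<in> {1..m}" "x \<le> r" if "block_counts bs i x \<noteq> 0" for i x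
      using block_counts_nonzero[OF _ that, of "{1..m}"] L assms(1) by (auto simp: lattice_words_iff)
    show "(\<Sum>x<Suc r. block_counts bs i x) = n" if "i \<in> {1..m}" for i
      using L that assms(1) unfolding sum_block_counts by (simp add: lattice_words_iff)
    show "(\<Sum>y<x. block_counts bs (Suc i) y) \<le> (\<Sum>y<x. block_counts bs i y)"
      if "i \<in> {1..<m}" for i x
      using L that split[of x] unfolding sum_block_counts lattice_words_iff by blast
  qed
next
  assume W: "block_counts bs \<in> weak_matrices n m r"
  have full: "count_list (concat (take x bs)) (Suc i) \<le> count_list (concat (take x bs)) i"
    if "i \<in> {1..<m}" for i x
    using weak_matricesD(3)[OF W, of i x] that by (simp add: sum_block_counts)
  show "concat bs \<in> lattice_words n m"
    unfolding lattice_words_iff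
  proof (intro conjI allI ballI impI)
    show "set (concat bs) \<subseteq> {1..m}"
      by (rule set_concat_subset_block_counts) (use weak_matricesD(1)[OF W] in auto)
    show "count_list (concat bs) i = n" if "i \<in> {1..m}" for i
      using weak_matricesD(2)[OF W, of i] that count_list_concat_block_counts[OF assms(1)] by simp
    fix u v i assume uv: "concat bs = u @ v" and i: "i \<in> {1..<m}"
    obtain us b c vs where bs: "bs = us @ (b @ c) # vs" and u: "u = concat us @ b"
      using uv assms(1) by (auto simp: concat_eq_append_conv split: if_splits)
    show "count_list u (Suc i) \<le> count_list u i"
    \<comment> \<open>The prefix \<open>u\<close> ends inside the block \<open>b @ c\<close>. If
      \<open>b\<close> contains \<open>Suc i\<close>, it already contains every \<open>i\<close> of
      the block, so comparison with the end of the block suffices. Otherwise no \<open>Suc i\<close>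
      was added since the start of the block.\<close>
    proof (cases "Suc i \<in> set b")
      case True
      then have "i \<notin> set c"
        using sorted[of "b @ c"] bs by (fastforce simp: sorted_append)
      then show ?thesis
        using full[OF i, of "Suc (length us)"] by (simp add: bs u)
    next
      case False
      then show ?thesis
        using full[OF i, of "length us"] by (simp add: bs u)
    qed
  qed
qed

text \<open>In a weakly decreasing list the letters above \<open>i\<close> form an initial
  segment.\<close>

lemma count_list_takeWhile_greater:
  fixes b :: "'a :: linorder list"
  assumes "sorted_wrt (\<ge>) b" and "i < j"
  shows "count_list (takeWhile (\<lambda>x. i < x) b) j = count_list b j"
  using assms(1)
proof (induction b)
  case (Cons a b)
  show ?case
  proof (cases "i < a")
    case False
    then have "j \<notin> set (a # b)" using Cons.prems assms(2) by auto
    then show ?thesis using False by (auto simp: count_list_0_iff)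
  qed (use Cons in simp)
qed simp

text \<open>In a weakly decreasing block every \<open>Suc i\<close> precedes every \<open>i\<close>.
  The critical prefix therefore contains all \<open>Suc i\<close> of the current block, while its
  \<open>i\<close> come only from earlier blocks.\<close>

lemma concat_ge_blocks_lattice_iff:
  assumes "length bs = Suc r" and sorted: "\<And>b. b \<in> set bs \<Longrightarrow> sorted_wrt (\<ge>) b"
  shows "concat bs \<in> lattice_words n m \<longleftrightarrow> block_counts bs \<in> strict_matrices n m r"
proof
  assume L: "concat bs \<in> lattice_words n m"
  have cnt: "count_list (concat bs) i = n" if "i \<in> {1..m}" for i
    using L that by (simp add: lattice_words_iff)
  show "block_counts bs \<in> strict_matrices n m r"
    unfolding strict_matrices_def mem_Collect_eq
  proof (intro conjI allI ballI impI)
    show "i \<in> {1..m}" "x \<le> r" if "block_counts bs i x \<noteq> 0" for i x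
      using block_counts_nonzero[OF _ that, of "{1..m}"] L assms(1) by (auto simp: lattice_words_iff)
    show "(\<Sum>x<Suc r. block_counts bs i x) = n" if "i \<in> {1..m}" for i
      using cnt that assms(1) unfolding sum_block_counts by simp
    fix i x assume i: "i \<in> {1..<m}"
    show "(\<Sum>y<Suc x. block_counts bs (Suc i) y) \<le> (\<Sum>y<x. block_counts bs i y)"
    proof (cases "x < length bs")
      \<comment> \<open>Past the last block both counts are complete and equal
        \<open>n\<close>.\<close>
      case False
      then show ?thesis
        using cnt[of i] cnt[of "Suc i"] i unfolding sum_block_counts by simp
    next
      case True
      define b where "b = bs ! x"
      \<comment> \<open>The critical prefix: it stops in block \<open>x\<close> just before the
        first letter that is at most \<open>i\<close>.\<close>
      let ?u = "concat (take x bs) @ takeWhile (\<lambda>z. i < z) b"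
      have "bs = take x bs @ b # drop (Suc x) bs"
        using True by (simp add: b_def id_take_nth_drop)
      then have "concat bs = ?u @ dropWhile (\<lambda>z. i < z) b @ concat (drop (Suc x) bs)"
        by (metis append.assoc concat.simps(2) concat_append takeWhile_dropWhile_id)
      then have "count_list ?u (Suc i) \<le> count_list ?u i"
        using L i unfolding lattice_words_iff by blast
      moreover have "i \<notin> set (takeWhile (\<lambda>z. i < z) b)"
        by (auto dest: set_takeWhileD)
      moreover have "sorted_wrt (\<ge>) b"
        using True by (intro sorted) (simp add: b_def)
      ultimately show ?thesis
        using True by (simp del: sum.lessThan_Suc add: sum_block_counts take_Suc_conv_app_nth
            count_list_takeWhile_greater flip: b_def)
    qed
  qed
next
  assume W: "block_counts bs \<in> strict_matrices n m r"
  show "concat bs \<in> lattice_words n m"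
    unfolding lattice_words_iff
  proof (intro conjI allI ballI impI)
    show "set (concat bs) \<subseteq> {1..m}"
      by (rule set_concat_subset_block_counts) (use strict_matricesD(1)[OF W] in auto)
    show "count_list (concat bs) i = n" if "i \<in> {1..m}" for i
      using strict_matricesD(2)[OF W, of i] that count_list_concat_block_counts[OF assms(1)] by simp
    fix u v i assume uv: "concat bs = u @ v" and i: "i \<in> {1..<m}"
    obtain us b c vs where bs: "bs = us @ (b @ c) # vs" and u: "u = concat us @ b"
      using uv assms(1) by (auto simp: concat_eq_append_conv split: if_splits)
    \<comment> \<open>Extending \<open>u\<close> to the end of its block can only add letters
      \<open>Suc i\<close>, and cutting it back to the start of the block can only remove letters
      \<open>i\<close>.\<close>
    have "count_list (concat (take (Suc (length us)) bs)) (Suc i) \<le>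
        count_list (concat (take (length us) bs)) i"
      using strict_matricesD(3)[OF W, of i "length us"] i unfolding sum_block_counts by simp
    then show "count_list u (Suc i) \<le> count_list u i"
      by (simp add: bs u)
  qed
qed

section \<open>Counting block lists by matrices\<close>

lemma card_le_blocks: "card (blocks (\<le>) (lattice_words n m) r) = card (weak_matrices n m r)"
proof -
  let ?B = "{bs. length bs = Suc r \<and> set bs \<subseteq> {b :: nat list. sorted b}}"
  have B: "blocks (\<le>) (lattice_words n m) r = {bs \<in> ?B. block_counts bs \<in> weak_matrices n m r}"
    unfolding blocks_def successively_conv_sorted_wrt[OF transp_on_le]
    using concat_le_blocks_lattice_iff by blast
  have "inj_on block_counts ?B"
    by (rule inj_on_block_counts) (auto intro: sorted_count_list_unique)
  then have "inj_on block_counts (blocks (\<le>) (lattice_words n m) r)"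
    unfolding B by (rule inj_on_subset) blast
  moreover have "block_counts ` blocks (\<le>) (lattice_words n m) r = weak_matrices n m r"
  proof (intro equalityI subsetI)
    fix a assume a: "a \<in> weak_matrices n m r"
    have "\<exists>bs. length bs = Suc r \<and> (\<forall>b\<in>set bs. sorted b) \<and> block_counts bs = a"
      using weak_matricesD(1)[OF a]
      by (intro ex_blocks_with_counts[of m] ex_sorted_count_list) (auto simp: less_Suc_eq_le)
    then show "a \<in> block_counts ` blocks (\<le>) (lattice_words n m) r"
      unfolding B using a by blast
  qed (auto simp: B)
  ultimately show ?thesis by (metis card_image)
qed

lemma card_ge_blocks: "card (blocks (\<ge>) (lattice_words n m) r) = card (strict_matrices n m r)"
proof -
  let ?B = "{bs. length bs = Suc r \<and> set bs \<subseteq> {b :: nat list. sorted_wrt (\<ge>) b}}"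
  have B: "blocks (\<ge>) (lattice_words n m) r = {bs \<in> ?B. block_counts bs \<in> strict_matrices n m r}"
    unfolding blocks_def successively_conv_sorted_wrt[OF transp_on_ge]
    using concat_ge_blocks_lattice_iff by blast
  \<comment> \<open>Reversal reduces decreasing blocks to increasing ones with the same letter
    counts.\<close>
  have "b = c" if "sorted_wrt (\<ge>) b" "sorted_wrt (\<ge>) c" "\<And>i. count_list b i = count_list c i"
    for b c :: "nat list"
    using sorted_count_list_unique[of "rev b" "rev c"] that by (simp add: sorted_wrt_rev)
  then have "inj_on block_counts ?B"
    by (intro inj_on_block_counts) blast
  then have "inj_on block_counts (blocks (\<ge>) (lattice_words n m) r)"
    unfolding B by (rule inj_on_subset) blast
  moreover have "block_counts ` blocks (\<ge>) (lattice_words n m) r = strict_matrices n m r"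
  proof (intro equalityI subsetI)
    fix a assume a: "a \<in> strict_matrices n m r"
    have "\<exists>b. sorted_wrt (\<ge>) b \<and> (\<forall>i. count_list b i = f i)"
      if f: "\<And>i. f i \<noteq> 0 \<Longrightarrow> i \<le> m" for f :: "nat \<Rightarrow> nat"
    proof -
      obtain b where "sorted b" "\<And>i. count_list b i = f i"
        using ex_sorted_count_list[of f, OF f] by blast
      then show ?thesis by (intro exI[of _ "rev b"]) (simp add: sorted_wrt_rev)
    qed
    then have "\<exists>bs. length bs = Suc r \<and> (\<forall>b\<in>set bs. sorted_wrt (\<ge>) b) \<and> block_counts bs = a"
      using strict_matricesD(1)[OF a]
      by (intro ex_blocks_with_counts[of m]) (auto simp: less_Suc_eq_le)
    then show "a \<in> block_counts ` blocks (\<ge>) (lattice_words n m) r"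
      unfolding B using a by blast
  qed (auto simp: B)
  ultimately show ?thesis by (metis card_image)
qed

subsection \<open>Tableaux as lattice words\<close>

lemma young_diagram_replicate: "young_diagram (replicate m n) = {..<m} \<times> {..<n}"
  by (auto simp: young_diagram_def)

text \<open>The Yamanouchi word: position \<open>k\<close>, counted from 0, records the row of the
  entry \<open>Suc k\<close>, with rows renumbered from 1.\<close>

definition word_of_tableau :: "nat \<Rightarrow> nat \<Rightarrow> (nat \<times> nat \<Rightarrow> nat) \<Rightarrow> nat list" where
  "word_of_tableau n m T =
     map (\<lambda>k. Suc (fst (inv_into ({..<m} \<times> {..<n}) T (Suc k)))) [0..<n * m]"

lemma length_word_of_tableau [simp]: "length (word_of_tableau n m T) = n * m"
  by (simp add: word_of_tableau_def)

lemma std_tableaux_rect: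
  "T \<in> std_tableaux (replicate m n) \<longleftrightarrow> T \<in> extensional ({..<m} \<times> {..<n}) \<and>
     bij_betw T ({..<m} \<times> {..<n}) {1..n * m} \<and>
     (\<forall>i<m. \<forall>j'<n. \<forall>j<j'. T (i, j) < T (i, j')) \<and>
     (\<forall>i'<m. \<forall>i<i'. \<forall>j<n. T (i, j) < T (i', j))"
  unfolding std_tableaux_def young_diagram_replicate
  by (auto simp: mult.commute intro: less_trans)

lemma count_list_take_eq_card:
  assumes "r \<le> length w"
  shows "count_list (take r w) a = card {k. k < r \<and> w ! k = a}"
  using assms
proof (induction r)
  case (Suc r)
  have "{k. k < Suc r \<and> w ! k = a} = {k. k < r \<and> w ! k = a} \<union> (if w ! r = a then {r} else {})"
    by (auto simp: less_Suc_eq)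
  with Suc show ?case
    by (simp add: take_Suc_conv_app_nth)
qed simp

lemma word_of_tableau_nth:
  assumes "inj_on T ({..<m} \<times> {..<n})" and "i < m" "j < n" and "T (i, j) = Suc k" "k < n * m"
  shows "word_of_tableau n m T ! k = Suc i"
proof -
  have "inv_into ({..<m} \<times> {..<n}) T (Suc k) = (i, j)"
    using inv_into_f_f[OF assms(1), of "(i, j)"] assms by simp
  then show ?thesis using assms by (simp add: word_of_tableau_def)
qed

text \<open>Both sides are the entries of row \<open>i\<close> that are at most \<open>r\<close>,
  read off from the word and from the tableau. This yields the prefix counts, and it recovers each
  row from the word.\<close>

lemma letter_positions:
  assumes T: "bij_betw T ({..<m} \<times> {..<n}) {1..n * m}" and "i < m"
  shows "Suc ` {k. k < r \<and> k < n * m \<and> word_of_tableau n m T ! k = Suc i} =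
    (\<lambda>j. T (i, j)) ` {j. j < n \<and> T (i, j) \<le> r}"
proof (intro equalityI subsetI)
  have inj: "inj_on T ({..<m} \<times> {..<n})" using T by (rule bij_betw_imp_inj_on)
  have rng: "T (i, j) \<in> {1..n * m}" if "i < m" "j < n" for i j
    using T that by (auto dest: bij_betwE)
  fix q
  {
    assume "q \<in> Suc ` {k. k < r \<and> k < n * m \<and> word_of_tableau n m T ! k = Suc i}"
    then obtain k where k: "q = Suc k" "k < r" "k < n * m" "word_of_tableau n m T ! k = Suc i"
      by blast
    then have "q \<in> T ` ({..<m} \<times> {..<n})"
      using T by (auto simp: bij_betw_def)
    then obtain i' j where "i' < m" "j < n" "q = T (i', j)" by auto
    then show "q \<in> (\<lambda>j. T (i, j)) ` {j. j < n \<and> T (i, j) \<le> r}"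
      using word_of_tableau_nth[OF inj, of i' j k] k by auto
  next
    assume "q \<in> (\<lambda>j. T (i, j)) ` {j. j < n \<and> T (i, j) \<le> r}"
    then obtain j where j: "j < n" "T (i, j) \<le> r" "q = T (i, j)" by blast
    then obtain k where "q = Suc k" "k < n * m"
      using rng[OF assms(2) j(1)] by (metis Suc_le_lessD atLeastAtMost_iff gr0_implies_Suc One_nat_def)
    then show "q \<in> Suc ` {k. k < r \<and> k < n * m \<and> word_of_tableau n m T ! k = Suc i}"
      using word_of_tableau_nth[OF inj assms(2) j(1), of k] j by auto
  }
qed

lemma count_word_of_tableau:
  assumes T: "bij_betw T ({..<m} \<times> {..<n}) {1..n * m}" and "i < m" and "r \<le> n * m"
  shows "count_list (take r (word_of_tableau n m T)) (Suc i) = card {j. j < n \<and> T (i, j) \<le> r}"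
proof -
  have "inj_on (\<lambda>j. T (i, j)) {j. j < n \<and> T (i, j) \<le> r}"
    using bij_betw_imp_inj_on[OF T] assms(2) by (auto simp: inj_on_def)
  then have "card {j. j < n \<and> T (i, j) \<le> r} =
      card (Suc ` {k. k < r \<and> k < n * m \<and> word_of_tableau n m T ! k = Suc i})"
    unfolding letter_positions[OF assms(1,2)] by (simp add: card_image)
  also have "\<dots> = card {k. k < r \<and> word_of_tableau n m T ! k = Suc i}"
    using assms(3) by (subst card_image) (auto intro!: arg_cong[of _ _ card])
  finally show ?thesis
    using assms(3) by (simp add: count_list_take_eq_card)
qed

lemma word_of_tableau_lattice:
  assumes "T \<in> std_tableaux (replicate m n)"
  shows "word_of_tableau n m T \<in> lattice_words n m"
proof -
  have col: "T (i, j) < T (i', j)" if "i < i'" "i' < m" "j < n" for i i' j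
    using assms that unfolding std_tableaux_rect by blast
  have T: "bij_betw T ({..<m} \<times> {..<n}) {1..n * m}"
    using assms unfolding std_tableaux_rect by blast
  have "set (word_of_tableau n m T) \<subseteq> {1..m}"
  proof
    fix a assume "a \<in> set (word_of_tableau n m T)"
    then obtain k where "k < n * m" "a = Suc (fst (inv_into ({..<m} \<times> {..<n}) T (Suc k)))"
      by (auto simp: word_of_tableau_def)
    moreover have "inv_into ({..<m} \<times> {..<n}) T (Suc k) \<in> {..<m} \<times> {..<n}"
      using T \<open>k < n * m\<close> by (intro inv_into_into) (auto simp: bij_betw_def)
    ultimately show "a \<in> {1..m}" by (auto simp: mem_Times_iff)
  qed
  moreover have "count_list (word_of_tableau n m T) i = n" if "i \<in> {1..m}" for i
  proof -
    from that obtain i0 where i0: "i = Suc i0" "i0 < m" by (cases i) auto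
    have "{j. j < n \<and> T (i0, j) \<le> n * m} = {..<n}"
      using T i0 by (auto dest: bij_betwE)
    then show ?thesis
      using count_word_of_tableau[OF T i0(2), of "n * m"] i0 by simp
  qed
  moreover have "count_list (take r (word_of_tableau n m T)) (Suc i) \<le>
      count_list (take r (word_of_tableau n m T)) i"
    if "r \<in> {1..n * m}" "i \<in> {1..<m}" for r i
  proof -
    from that obtain i0 where i0: "i = Suc i0" "Suc i0 < m" by (cases i) auto
    \<comment> \<open>By column strictness, an entry at most \<open>r\<close> in row
      \<open>Suc i0\<close> has an entry at most \<open>r\<close> directly above it.\<close>
    have "card {j. j < n \<and> T (Suc i0, j) \<le> r} \<le> card {j. j < n \<and> T (i0, j) \<le> r}"
      using col[of i0 "Suc i0"] i0 by (intro card_mono) (auto intro: less_imp_le order.trans)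
    then show ?thesis
      using count_word_of_tableau[OF T, of i0 r] count_word_of_tableau[OF T, of "Suc i0" r] that i0
      by simp
  qed
  ultimately show ?thesis by (auto simp: lattice_words_def)
qed

lemma inj_on_word_of_tableau: "inj_on (word_of_tableau n m) (std_tableaux (replicate m n))"
proof (intro inj_onI ext)
  fix S T and c :: "nat \<times> nat"
  assume S: "S \<in> std_tableaux (replicate m n)" and T: "T \<in> std_tableaux (replicate m n)"
    and eq: "word_of_tableau n m S = word_of_tableau n m T"
  have Sb: "bij_betw S ({..<m} \<times> {..<n}) {1..n * m}" and Tb: "bij_betw T ({..<m} \<times> {..<n}) {1..n * m}"
    using S T unfolding std_tableaux_rect by blast+
  obtain i j where c: "c = (i, j)" by (cases c)
  show "S c = T c"
  proof (cases "i < m \<and> j < n")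
    case False
    then show ?thesis
      using S T unfolding std_tableaux_rect c extensional_def by auto
  next
    case True
    have full: "{j. j < n \<and> U (i, j) \<le> n * m} = {..<n}"
      if "bij_betw U ({..<m} \<times> {..<n}) {1..n * m}" for U
      using that True by (auto dest: bij_betwE)
    \<comment> \<open>The word determines each row as a set, and an increasing row is determined by
      its set of entries.\<close>
    have "(\<lambda>j. S (i, j)) ` {..<n} = (\<lambda>j. T (i, j)) ` {..<n}"
      using letter_positions[OF Sb, of i "n * m"] letter_positions[OF Tb, of i "n * m"] True
      unfolding eq full[OF Sb] full[OF Tb] by simp
    then have "map (\<lambda>j. S (i, j)) [0..<n] = map (\<lambda>j. T (i, j)) [0..<n]"
      using S T True unfolding std_tableaux_rect
      by (intro strict_sorted_equal) (auto simp: sorted_wrt_iff_nth_less lessThan_atLeast0)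
    then show ?thesis
      using True c by (simp add: list_eq_iff_nth_eq)
  qed
qed

section \<open>Reconstruction of a tableau from its lattice word\<close>

lemma card_less_nth_sorted:
  fixes xs :: "'a :: linorder list"
  assumes "sorted_wrt (<) xs" and "j < length xs"
  shows "card {x \<in> set xs. x < xs ! j} = j"
proof -
  have "xs ! i < xs ! j \<longleftrightarrow> i < j" if "i < length xs" for i
    using assms that sorted_wrt_nth_less[of "(<)" xs]
    by (metis less_asym' linorder_neqE_nat less_irrefl)
  then have "{x \<in> set xs. x < xs ! j} = (!) xs ` {..<j}"
    using assms(2) by (auto simp: in_set_conv_nth intro: less_trans)
  moreover have "inj_on ((!) xs) {..<j}"
    using assms by (intro inj_on_nth) (auto simp: strict_sorted_iff)
  ultimately show ?thesis by (simp add: card_image)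
qed

lemma word_of_tableau_surj:
  assumes w: "w \<in> lattice_words n m"
  shows "\<exists>T\<in>std_tableaux (replicate m n). word_of_tableau n m T = w"
proof -
  have len: "length w = n * m" and letters_set: "set w \<subseteq> {1..m}"
    and cnt: "\<And>i. i < m \<Longrightarrow> count_list w (Suc i) = n"
    and lat: "\<And>r i. r \<in> {1..n * m} \<Longrightarrow> Suc i < m \<Longrightarrow>
      count_list (take r w) (Suc (Suc i)) \<le> count_list (take r w) (Suc i)"
    using w by (simp_all add: lattice_words_def)
  have letters: "w ! k \<in> {1..m}" if "k < n * m" for k
    using nth_mem[of k w] that len by (intro subsetD[OF letters_set]) simp
  define P where "P i = {k. k < n * m \<and> w ! k = Suc i}" for i
  \<comment> \<open>The list \<open>p i\<close> is the future row \<open>i\<close>, up to the shift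
    from positions to entries.\<close>
  define p where "p i = sorted_list_of_set (P i)" for i
  have finP: "finite (P i)" for i by (simp add: P_def)
  have sp: "sorted_wrt (<) (p i)" and setp: "set (p i) = P i" for i
    by (simp_all add: p_def finP)
  have lenp: "length (p i) = n" if "i < m" for i
    using count_list_take_eq_card[of "n * m" w "Suc i"] cnt[OF that] len
    by (simp add: p_def P_def)
  have pP: "p i ! j \<in> P i" if "i < m" "j < n" for i j
    using that lenp setp by (metis nth_mem)
  \<comment> \<open>Otherwise the prefix ending at position \<open>k\<close> would contain
    \<open>Suc j\<close> letters \<open>Suc (Suc i)\<close> but at most \<open>j\<close> letters
    \<open>Suc i\<close>, against the lattice condition.\<close>
  have step: "p i ! j < p (Suc i) ! j" if "Suc i < m" "j < n" for i j
  proof (rule ccontr)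
    assume neg: "\<not> p i ! j < p (Suc i) ! j"
    define k where "k = p (Suc i) ! j"
    have k: "k \<in> P (Suc i)" using pP that by (simp add: k_def)
    have below: "card {x \<in> P (Suc i). x < k} = j" and i_below: "card {x \<in> P i. x < p i ! j} = j"
      using card_less_nth_sorted[OF sp, of j] that lenp setp by (auto simp: k_def)
    have "{q. q < Suc k \<and> w ! q = Suc (Suc i)} = insert k {x \<in> P (Suc i). x < k}"
      using k by (auto simp: P_def less_Suc_eq)
    then have "count_list (take (Suc k) w) (Suc (Suc i)) = Suc j"
      using below k finP by (subst count_list_take_eq_card) (auto simp: P_def len)
    moreover have "{q. q < Suc k \<and> w ! q = Suc i} \<subseteq> {x \<in> P i. x < p i ! j}"
      using k neg by (auto simp: P_def less_Suc_eq k_def)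
    then have "card {q. q < Suc k \<and> w ! q = Suc i} \<le> j"
      using i_below card_mono[of "{x \<in> P i. x < p i ! j}"] finP by fastforce
    then have "count_list (take (Suc k) w) (Suc i) \<le> j"
      using k by (subst count_list_take_eq_card) (auto simp: P_def len)
    ultimately show False
      using lat[of "Suc k" i] k that by (simp add: P_def)
  qed
  have col: "p i ! j < p i' ! j" if "i < i'" "i' < m" "j < n" for i i' j
    using that
  proof (induction i' rule: less_induct)
    case (less i')
    then obtain l where l: "i' = Suc l" by (cases i') auto
    show ?case
    proof (cases "i = l")
      case False
      then have "p i ! j < p l ! j" using less l by simp
      then show ?thesis using step[of l j] less l by simp
    qed (use step less l in simp)
  qed
  define T where "T = restrict (\<lambda>(i, j). Suc (p i ! j)) ({..<m} \<times> {..<n})"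
  have TT: "T (i, j) = Suc (p i ! j)" if "i < m" "j < n" for i j
    using that by (simp add: T_def)
  have inj: "inj_on T ({..<m} \<times> {..<n})"
  proof (rule inj_onI, clarify)
    fix i j i' j'
    assume ij: "i < m" "j < n" "i' < m" "j' < n" and "T (i, j) = T (i', j')"
    then have e: "p i ! j = p i' ! j'" by (simp add: TT)
    then have "i = i'"
      using pP[of i j] pP[of i' j'] ij by (simp add: P_def)
    moreover have "distinct (p i)" by (simp add: p_def)
    ultimately show "i = i' \<and> j = j'"
      using e ij lenp by (simp add: nth_eq_iff_index_eq)
  qed
  have "T ` ({..<m} \<times> {..<n}) = {1..n * m}"
  proof (intro equalityI subsetI)
    fix q assume "q \<in> T ` ({..<m} \<times> {..<n})"
    then show "q \<in> {1..n * m}" using pP by (fastforce simp: TT P_def)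
  next
    fix q assume q: "q \<in> {1..n * m}"
    then obtain k where k: "q = Suc k" "k < n * m" by (cases q) auto
    then obtain i where i: "w ! k = Suc i" "i < m" using letters[of k] by (cases "w ! k") auto
    then have "k \<in> set (p i)" using k by (simp add: setp P_def)
    then obtain j where "j < n" "p i ! j = k" using lenp i by (auto simp: in_set_conv_nth)
    then show "q \<in> T ` ({..<m} \<times> {..<n})"
      using i k TT by (intro image_eqI[of _ _ "(i, j)"]) auto
  qed
  with inj have bij: "bij_betw T ({..<m} \<times> {..<n}) {1..n * m}" by (simp add: bij_betw_def)
  have "T \<in> std_tableaux (replicate m n)"
    unfolding std_tableaux_rect
  proof (intro conjI allI impI)
    show "T (i, j) < T (i, j')" if "i < m" "j' < n" "j < j'" for i j j'
      using that sorted_wrt_nth_less[OF sp, of j j' i] lenp by (simp add: TT)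
    show "T (i, j) < T (i', j)" if "i' < m" "i < i'" "j < n" for i i' j
      using that col by (simp add: TT)
  qed (rule bij | simp add: T_def)+
  moreover have "word_of_tableau n m T = w"
  proof (rule nth_equalityI)
    fix k assume "k < length (word_of_tableau n m T)"
    then have k: "k < n * m" by simp
    then obtain i where i: "w ! k = Suc i" "i < m" using letters[of k] by (cases "w ! k") auto
    then have "k \<in> set (p i)" using k by (simp add: setp P_def)
    then obtain j where "j < n" "p i ! j = k" using lenp i by (auto simp: in_set_conv_nth)
    then show "word_of_tableau n m T ! k = w ! k"
      using word_of_tableau_nth[OF inj, of i j k] i k by (simp add: TT)
  qed (simp add: len)
  ultimately show ?thesis by blast
qed

lemma bij_betw_word_of_tableau:
  "bij_betw (word_of_tableau n m) (std_tableaux (replicate m n)) (lattice_words n m)"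
  unfolding bij_betw_def
  using inj_on_word_of_tableau word_of_tableau_lattice word_of_tableau_surj by blast

text \<open>A lower row has a larger index, so tableau descents are strict ascents of the word. The
  entry \<open>Suc k\<close> sits at position \<open>k\<close>, so the two index sets differ by a
  shift by one.\<close>

lemma tableau_des_eq_breaks:
  assumes "T \<in> std_tableaux (replicate m n)"
  shows "tableau_des (replicate m n) T = breaks (\<ge>) (word_of_tableau n m T)"
proof -
  let ?w = "word_of_tableau n m T"
  have T: "bij_betw T ({..<m} \<times> {..<n}) {1..n * m}"
    using assms unfolding std_tableaux_rect by blast
  have inj: "inj_on T ({..<m} \<times> {..<n})" using T by (rule bij_betw_imp_inj_on)
  have ex: "\<exists>i j. i < m \<and> j < n \<and> T (i, j) = Suc k" if "k < n * m" for k
  proof -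
    have "Suc k \<in> T ` ({..<m} \<times> {..<n})" using T that by (auto simp: bij_betw_def)
    then obtain c where "c \<in> {..<m} \<times> {..<n}" "T c = Suc k" by auto
    then show ?thesis by (cases c) auto
  qed
  have "{k. \<exists>i j i' j'. (i, j) \<in> young_diagram (replicate m n) \<and>
      (i', j') \<in> young_diagram (replicate m n) \<and> T (i, j) = k \<and> T (i', j') = Suc k \<and> i < i'} =
    Suc ` {k. Suc k < length ?w \<and> \<not> ?w ! k \<ge> ?w ! Suc k}" (is "?A = Suc ` ?B")
  proof (intro equalityI subsetI)
    fix q assume "q \<in> ?A"
    then obtain i j i' j' where ij: "i < m" "j < n" "i' < m" "j' < n" "T (i, j) = q"
      "T (i', j') = Suc q" "i < i'"
      by (auto simp: young_diagram_replicate)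
    have "q \<in> {1..n * m}" "Suc q \<in> {1..n * m}"
      using bij_betwE[OF T, rule_format, of "(i, j)"] bij_betwE[OF T, rule_format, of "(i', j')"] ij
      by simp_all
    then obtain k where k: "q = Suc k" "Suc k < n * m" by (cases q) auto
    then have "?w ! k = Suc i" "?w ! Suc k = Suc i'"
      using word_of_tableau_nth[OF inj] ij by auto
    with k ij show "q \<in> Suc ` ?B" by auto
  next
    fix q assume "q \<in> Suc ` ?B"
    then obtain k where k: "q = Suc k" "Suc k < n * m" "?w ! k < ?w ! Suc k" by auto
    obtain i j where ij: "i < m" "j < n" "T (i, j) = Suc k" using ex[of k] k by auto
    obtain i' j' where ij': "i' < m" "j' < n" "T (i', j') = Suc (Suc k)" using ex[of "Suc k"] k by auto
    have "i < i'"
      using word_of_tableau_nth[OF inj ij] word_of_tableau_nth[OF inj ij'] k by simp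
    then show "q \<in> ?A"
      using ij ij' k(1) unfolding young_diagram_replicate by blast
  qed
  then show ?thesis
    unfolding tableau_des_def breaks_def by (simp add: card_image)
qed

subsection \<open>Comparison of ascents and descents\<close>

text \<open>Both sums are \<open>(1 - fps_X) ^ Suc (n * m)\<close> times a series counting block
  lists, and the row shift relates these two series by the factor
  \<open>fps_X ^ (m - 1)\<close>.\<close>

lemma sum_ascents_eq_sum_descents:
  assumes "m \<ge> 1" and "n \<ge> 1"
  shows "(\<Sum>w\<in>lattice_words n m. fps_X ^ breaks (\<ge>) w :: int fps) =
    fps_X ^ (m - 1) * (\<Sum>w\<in>lattice_words n m. fps_X ^ word_des w)"
proof -
  have len: "length w = n * m" if "w \<in> lattice_words n m" for w
    using that by (simp add: lattice_words_def)
  have des: "word_des w = breaks (\<le>) w" for w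
    by (simp add: word_des_def breaks_def not_le)
  have "Abs_fps (\<lambda>r. int (card (blocks (\<ge>) (lattice_words n m) r))) =
      fps_X ^ (m - 1) * Abs_fps (\<lambda>r. int (card (blocks (\<le>) (lattice_words n m) r)))"
    by (rule fps_ext)
      (simp add: card_le_blocks card_ge_blocks card_strict_matrices[OF assms] fps_X_power_mult_nth)
  moreover have "(\<Sum>w\<in>lattice_words n m. fps_X ^ breaks R w) = (1 - fps_X) ^ Suc (n * m) *
      Abs_fps (\<lambda>r. int (card (blocks R (lattice_words n m) r)))" for R
    by (rule sum_power_breaks[OF finite_lattice_words len])
  ultimately show ?thesis
    unfolding des by (simp only: mult.left_commute)
qed

theorem theorem2p1:
  fixes m n :: nat
  assumes "m \<ge> 1" and "n \<ge> 1"
  shows "fps_to_fls (fps_of_poly (lattice_word_poly n m)) =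
    (fls_X_intpow (1 - int m) :: int fls) *
    (\<Sum>T\<in>std_tableaux (replicate m n). fls_X ^ tableau_des (replicate m n) T)"
proof -
  let ?N = "\<Sum>w\<in>lattice_words n m. fps_X ^ word_des w :: int fps"
  have to_fls_sum: "fps_to_fls (\<Sum>x\<in>A. f x) = (\<Sum>x\<in>A. fps_to_fls (f x))"
    for f :: "nat list \<Rightarrow> int fps" and A
    by (induction A rule: infinite_finite_induct) simp_all
  have "(\<Sum>T\<in>std_tableaux (replicate m n). fls_X ^ tableau_des (replicate m n) T) =
      (\<Sum>T\<in>std_tableaux (replicate m n). fls_X ^ breaks (\<ge>) (word_of_tableau n m T) :: int fls)"
    by (simp add: tableau_des_eq_breaks)
  also have "\<dots> = (\<Sum>w\<in>lattice_words n m. fls_X ^ breaks (\<ge>) w)"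
    by (rule sum.reindex_bij_betw[OF bij_betw_word_of_tableau])
  also have "\<dots> = fps_to_fls (fps_X ^ (m - 1) * ?N)"
    unfolding sum_ascents_eq_sum_descents[OF assms, symmetric]
    by (simp only: to_fls_sum fps_to_fls_power fps_X_to_fls)
  also have "\<dots> = fls_X ^ (m - 1) * fps_to_fls ?N"
    by (simp only: fls_times_fps_to_fls fps_to_fls_power fps_X_to_fls)
  \<comment> \<open>Since \<open>m \<ge> 1\<close>, the truncated exponent agrees with the integer
    \<open>int m - 1\<close>, which cancels against \<open>1 - int m\<close>.\<close>
  also have "fls_X ^ (m - 1) = (fls_X_intpow (int m - 1) :: int fls)"
    using assms(1) by (simp only: fls_X_power_conv_shift_1 of_nat_diff of_nat_1)
  finally have "fls_X_intpow (1 - int m) *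
      (\<Sum>T\<in>std_tableaux (replicate m n). fls_X ^ tableau_des (replicate m n) T) =
      (fls_X_intpow (1 - int m) * fls_X_intpow (int m - 1)) * fps_to_fls ?N"
    by (simp only: mult.assoc)
  also have "\<dots> = fps_to_fls ?N"
    unfolding fls_X_intpow_times_fls_X_intpow by simp
  also have "?N = fps_of_poly (lattice_word_poly n m)"
    by (simp add: lattice_word_poly_def fps_of_poly_sum fps_of_poly_monom')
  finally show ?thesis by simp
qed

end
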